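(* Every graph $G$ has a $1$-bend drawing using at most $\Delta(G)+1$ distinct edge slopes.
   Context: $\Delta(G)$ is the maximum degree of $G$. A (straight-line) drawing of a graph maps its vertices to distinct points in the plane and represents each edge by the closed line segment between its endpoints, such that each edge segment intersects no vertex other than its own endpoints. The slope of an edge is the angle in $[0,\pi)$ from the $x$-axis to the line containing it. For a graph $G$, let $G'$ be obtained by subdividing each edge once: each edge $vw$ is replaced by a path $v x_{vw} w$ through a new vertex $x_{vw}$. A $1$-bend drawing of $G$ is a (straight-line) drawing of $G'$; its slopes are the slopes of the edges of $G'$. *)

theory Defs
  imports "HOL-Analysis.Analysis"
begin

definition simple_graph :: "'a set \<Rightarrow> 'a set set \<Rightarrow> bool" where
  "simple_graph V E \<longleftrightarrow> finite V \<and> (\<forall>e\<in>E. e \<subseteq> V \<and> card e = 2)"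

definition vertex_degree :: "'a set set \<Rightarrow> 'a \<Rightarrow> nat" where
  "vertex_degree E v = card {e \<in> E. v \<in> e}"

text \<open>The inserted 0 only matters for the graph without vertices, whose maximum degree is 0.\<close>

definition max_degree :: "'a set \<Rightarrow> 'a set set \<Rightarrow> nat" where
  "max_degree V E = Max (insert 0 (vertex_degree E ` V))"

definition is_drawing :: "'a set \<Rightarrow> 'a set set \<Rightarrow> ('a \<Rightarrow> real \<times> real) \<Rightarrow> bool" where
  "is_drawing V E f \<longleftrightarrow> inj_on f V \<and>
     (\<forall>u v w. {u, v} \<in> E \<longrightarrow> w \<in> V \<longrightarrow> w \<notin> {u, v} \<longrightarrow> f w \<notin> closed_segment (f u) (f v))"

definition slope :: "real \<times> real \<Rightarrow> real \<times> real \<Rightarrow> real" where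
  "slope p q = (THE \<theta>. 0 \<le> \<theta> \<and> \<theta> < pi \<and> (\<exists>r. q - p = r *\<^sub>R (cos \<theta>, sin \<theta>)))"

lemma slope_ex1:
  fixes p q :: "real \<times> real"
  assumes "p \<noteq> q"
  shows "\<exists>!\<theta>. 0 \<le> \<theta> \<and> \<theta> < pi \<and> (\<exists>r. q - p = r *\<^sub>R (cos \<theta>, sin \<theta>))"
proof (rule ex_ex1I)
  obtain x y where xy: "q - p = (x, y)" by force
  obtain r a where ra: "x = r * cos a" "y = r * sin a" "0 \<le> a" "a < 2 * pi"
  proof -
    have "Complex x y = rcis (cmod (Complex x y)) (Arg2pi (Complex x y))"
      by (simp add: rcis_def cis_conv_exp flip: Arg2pi_eq)
    then show ?thesis
      using that[of "cmod (Complex x y)" "Arg2pi (Complex x y)"] Arg2pi_ge_0 Arg2pi_lt_2pi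
      by (simp add: complex_eq_iff)
  qed
  show "\<exists>\<theta>. 0 \<le> \<theta> \<and> \<theta> < pi \<and> (\<exists>r. q - p = r *\<^sub>R (cos \<theta>, sin \<theta>))"
  proof (cases "a < pi")
    case True
    then show ?thesis using ra xy by (intro exI[of _ a] conjI exI[of _ r]) auto
  next
    case False
    then show ?thesis
      using ra xy by (intro exI[of _ "a - pi"] conjI exI[of _ "- r"]) (auto simp: cos_diff sin_diff)
  qed
next
  fix a b
  assume "0 \<le> a \<and> a < pi \<and> (\<exists>r. q - p = r *\<^sub>R (cos a, sin a))"
    and "0 \<le> b \<and> b < pi \<and> (\<exists>r. q - p = r *\<^sub>R (cos b, sin b))"
  then obtain r s where a: "0 \<le> a" "a < pi" "q - p = r *\<^sub>R (cos a, sin a)"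
    and b: "0 \<le> b" "b < pi" "q - p = s *\<^sub>R (cos b, sin b)" by blast
  have nz: "r \<noteq> 0" "s \<noteq> 0" using a(3) b(3) assms by (metis scaleR_zero_left eq_iff_diff_eq_0)+
  have e: "r * cos a = s * cos b" "r * sin a = s * sin b" using a(3) b(3) by auto
  have "(r * s) * sin (a - b) = (r * sin a) * (s * cos b) - (r * cos a) * (s * sin b)"
    by (simp add: sin_diff algebra_simps)
  also have "\<dots> = 0" using e by simp
  finally have "sin (a - b) = 0" using nz by simp
  then show "a = b"
    using a(1,2) b(1,2) sin_eq_0_pi[of "a - b"] by simp
qed

definition edge_slopes :: "'a set set \<Rightarrow> ('a \<Rightarrow> real \<times> real) \<Rightarrow> real set" where
  "edge_slopes E f = {slope (f u) (f v) | u v. {u, v} \<in> E}"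

text \<open>In the subdivision, \<open>Inl v\<close> is the original vertex \<open>v\<close> and \<open>Inr e\<close> is the
  division vertex of the edge \<open>e\<close>.\<close>

definition subdiv_vertices :: "'a set \<Rightarrow> 'a set set \<Rightarrow> ('a + 'a set) set" where
  "subdiv_vertices V E = Inl ` V \<union> Inr ` E"

definition subdiv_edges :: "'a set set \<Rightarrow> ('a + 'a set) set set" where
  "subdiv_edges E = {{Inl v, Inr e} | v e. e \<in> E \<and> v \<in> e}"

definition one_bend_drawing ::
    "'a set \<Rightarrow> 'a set set \<Rightarrow> ('a + 'a set \<Rightarrow> real \<times> real) \<Rightarrow> bool" where
  "one_bend_drawing V E f \<longleftrightarrow> is_drawing (subdiv_vertices V E) (subdiv_edges E) f"

definition one_bend_slopes :: "'a set set \<Rightarrow> ('a + 'a set \<Rightarrow> real \<times> real) \<Rightarrow> real set" where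
  "one_bend_slopes E f = edge_slopes (subdiv_edges E) f"

end

theory Submission
  imports Defs
begin

text \<open>
  Every half-edge (an edge together with one of its ends) receives one of the slopes
  \<open>0, \<dots>, \<Delta>\<close> such that half-edges at the same vertex, and the two halves of the same edge,
  get different slopes. A half-edge at \<open>v\<close> has at most \<open>\<Delta> - 1\<close> conflicts at \<open>v\<close> and one with
  its other half, so the greedy algorithm succeeds. The vertices are placed on the \<open>y\<close>-axis at
  heights \<open>M ^ 0, M ^ 1, \<dots>\<close> with \<open>M > 2 \<Delta>\<close>; the bend of \<open>vw\<close> is the intersection of the lines
  through \<open>v\<close> and \<open>w\<close> with the slopes of the two halves. If lines of slopes \<open>i, j, k\<close> through
  three different vertices of heights \<open>a, b, d\<close> were concurrent, then
  \<open>(j - k) a + (k - i) b + (i - j) d = 0\<close>, which is impossible because the highest power of \<open>M\<close>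
  dominates. So no bend lies on a half-edge not incident to it.
\<close>

text \<open>Induction on \<open>X\<close>: the degree bound passes to subsets, and the at most
  \<open>D\<close> neighbours of the element added last cannot use up the \<open>D + 1\<close>
  values in \<open>{..D}\<close>.\<close>

lemma greedy_colouring:
  fixes R :: "'b \<Rightarrow> 'b \<Rightarrow> bool" and D :: nat
  assumes "finite X" and sym: "\<And>x y. R x y \<Longrightarrow> R y x"
    and "\<And>x. x \<in> X \<Longrightarrow> card {y \<in> X. y \<noteq> x \<and> R x y} \<le> D"
  shows "\<exists>c. (\<forall>x\<in>X. c x \<le> D) \<and> (\<forall>x\<in>X. \<forall>y\<in>X. x \<noteq> y \<longrightarrow> R x y \<longrightarrow> c x \<noteq> (c y :: nat))"
  using assms(1,3)
proof (induction X rule: finite_induct)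
  case empty
  then show ?case by simp
next
  case (insert a X)
  have deg: "card {y \<in> X. y \<noteq> x \<and> R x y} \<le> D" if "x \<in> X" for x
  proof -
    have "card {y \<in> X. y \<noteq> x \<and> R x y} \<le> card {y \<in> insert a X. y \<noteq> x \<and> R x y}"
      using insert.hyps(1) by (intro card_mono) auto
    also have "\<dots> \<le> D" using insert.prems that by blast
    finally show ?thesis .
  qed
  have "\<exists>c. (\<forall>x\<in>X. c x \<le> D) \<and> (\<forall>x\<in>X. \<forall>y\<in>X. x \<noteq> y \<longrightarrow> R x y \<longrightarrow> c x \<noteq> (c y :: nat))"
    by (rule insert.IH) (rule deg)
  then obtain c where c: "\<forall>x\<in>X. c x \<le> D"
    "\<forall>x\<in>X. \<forall>y\<in>X. x \<noteq> y \<longrightarrow> R x y \<longrightarrow> c x \<noteq> (c y :: nat)"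
    by (elim exE conjE)
  let ?N = "{y \<in> insert a X. y \<noteq> a \<and> R a y}"
  have "card (c ` ?N) \<le> card ?N" using insert.hyps(1) by (intro card_image_le) simp
  also have "\<dots> \<le> D" using insert.prems by blast
  finally have "card (c ` ?N) < card {..D}" by simp
  moreover have "finite (c ` ?N)" using insert.hyps(1) by simp
  ultimately have "\<not> {..D} \<subseteq> c ` ?N" using card_mono leD by blast
  then obtain k where k: "k \<le> D" "k \<notin> c ` ?N" by blast
  show ?case
  proof (intro exI[of _ "c(a := k)"] conjI ballI impI)
    show "(c(a := k)) x \<le> D" if "x \<in> insert a X" for x
      using that c(1) k(1) by auto
    show "(c(a := k)) x \<noteq> (c(a := k)) y"
      if "x \<in> insert a X" "y \<in> insert a X" "x \<noteq> y" "R x y" for x y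
      using that c(2) k(2) sym[OF that(4)] by auto
  qed
qed

lemma half_edge_colouring:
  assumes "simple_graph V E"
  obtains c :: "'a \<Rightarrow> 'a set \<Rightarrow> nat" where
    "\<And>v e. e \<in> E \<Longrightarrow> v \<in> e \<Longrightarrow> c v e \<le> max_degree V E"
    "\<And>v e e'. e \<in> E \<Longrightarrow> e' \<in> E \<Longrightarrow> v \<in> e \<Longrightarrow> v \<in> e' \<Longrightarrow> e \<noteq> e' \<Longrightarrow> c v e \<noteq> c v e'"
    "\<And>v w e. e \<in> E \<Longrightarrow> v \<in> e \<Longrightarrow> w \<in> e \<Longrightarrow> v \<noteq> w \<Longrightarrow> c v e \<noteq> c w e"
proof -
  define X where "X = {(v, e). e \<in> E \<and> v \<in> e}"
  define R where "R = (\<lambda>x y :: 'a \<times> 'a set. fst x = fst y \<or> snd x = snd y)"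
  have finV: "finite V" and E: "\<And>e. e \<in> E \<Longrightarrow> e \<subseteq> V \<and> card e = 2"
    using assms by (auto simp: simple_graph_def)
  have finE: "finite E" using E finV by (meson Pow_iff finite_Pow_iff finite_subset subsetI)
  have "X \<subseteq> V \<times> E" using E by (auto simp: X_def)
  then have finX: "finite X" using finV finE finite_subset by blast
  have deg: "card {y \<in> X. y \<noteq> x \<and> R x y} \<le> max_degree V E" if "x \<in> X" for x
  proof -
    obtain v e where x: "x = (v, e)" "e \<in> E" "v \<in> e" using \<open>x \<in> X\<close> by (auto simp: X_def)
    let ?A = "{e' \<in> E. v \<in> e'}"
    have fin: "finite e" using E[OF x(2)] finV finite_subset by blast
    have "{y \<in> X. y \<noteq> x \<and> R x y} \<subseteq> Pair v ` (?A - {e}) \<union> (\<lambda>w. (w, e)) ` (e - {v})"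
      by (auto simp: X_def R_def x)
    then have "card {y \<in> X. y \<noteq> x \<and> R x y}
        \<le> card (Pair v ` (?A - {e}) \<union> (\<lambda>w. (w, e)) ` (e - {v}))"
      using fin finE by (intro card_mono) auto
    also have "\<dots> \<le> card (Pair v ` (?A - {e})) + card ((\<lambda>w. (w, e)) ` (e - {v}))"
      by (rule card_Un_le)
    also have "\<dots> \<le> card (?A - {e}) + card (e - {v})"
      using fin finE by (intro add_mono card_image_le) auto
    \<comment> \<open>The \<open>deg v - 1\<close> other edges at \<open>v\<close> and the single
      other end of \<open>e\<close> add up to \<open>deg v\<close>; as \<open>e\<close> lies in
      \<open>?A\<close>, the natural subtraction does not truncate.\<close>
    also have "\<dots> = card ?A"
      using x E[OF x(2)] finE fin card_gt_0_iff[of ?A] by (auto simp: card_Diff_singleton)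
    also have "\<dots> = vertex_degree E v" by (simp add: vertex_degree_def)
    also have "\<dots> \<le> max_degree V E"
      unfolding max_degree_def using finV E[OF x(2)] x(3) by (intro Max_ge) auto
    finally show ?thesis .
  qed
  obtain c where c: "\<forall>x\<in>X. c x \<le> max_degree V E"
    "\<forall>x\<in>X. \<forall>y\<in>X. x \<noteq> y \<longrightarrow> R x y \<longrightarrow> c x \<noteq> (c y :: nat)"
    using greedy_colouring[of X R, OF finX _ deg] unfolding R_def by metis
  show ?thesis
    by (rule that[of "curry c"]) (use c in \<open>auto simp: X_def R_def\<close>)
qed

text \<open>The leading term has absolute value at least \<open>M * M ^ (a - 1)\<close>, whereas the
  other two together reach at most \<open>2 * D * M ^ (a - 1)\<close>.\<close>

lemma top_power_dominates:
  fixes p q r :: int and M D :: nat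
  assumes "p \<noteq> 0" "\<bar>q\<bar> \<le> D" "\<bar>r\<bar> \<le> D" "2 * D < M" "b < a" "d < a"
  shows "p * int M ^ a + q * int M ^ b + r * int M ^ d \<noteq> 0"
proof
  assume eq: "p * int M ^ a + q * int M ^ b + r * int M ^ d = 0"
  obtain n where n: "a = Suc n" using assms(5) by (cases a) auto
  have bound: "\<bar>s * int M ^ m\<bar> \<le> int D * int M ^ n" if "\<bar>s\<bar> \<le> int D" "m < a" for s m
    using that assms(4) n by (auto simp: abs_mult intro!: mult_mono power_increasing)
  have "int M ^ a \<le> \<bar>p * int M ^ a\<bar>"
    using assms(1) mult_right_mono[of 1 "\<bar>p\<bar>" "int M ^ a"] by (simp add: abs_mult)
  also have "\<dots> \<le> \<bar>q * int M ^ b\<bar> + \<bar>r * int M ^ d\<bar>" using eq by linarith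
  also have "\<dots> \<le> int (2 * D) * int M ^ n"
    using bound[OF assms(2,5)] bound[OF assms(3,6)] by simp
  also have "\<dots> < int M * int M ^ n"
    using assms(4) by (intro mult_strict_right_mono) auto
  finally show False using n by simp
qed

lemma distinct_powers_independent:
  fixes p q r :: int and M D :: nat
  assumes "p \<noteq> 0" "q \<noteq> 0" "r \<noteq> 0" "\<bar>p\<bar> \<le> D" "\<bar>q\<bar> \<le> D" "\<bar>r\<bar> \<le> D" "2 * D < M"
    and "a \<noteq> b" "a \<noteq> d" "b \<noteq> d"
  shows "p * int M ^ a + q * int M ^ b + r * int M ^ d \<noteq> 0"
proof -
  consider "b < a" "d < a" | "a < b" "d < b" | "a < d" "b < d" using assms(8-10) by linarith
  then show ?thesis
  proof cases
    case 1
    then show ?thesis using top_power_dominates[of p q D r M b a d] assms by simp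
  next
    case 2
    then show ?thesis using top_power_dominates[of q p D r M a b d] assms by (simp add: add.commute)
  next
    case 3
    then show ?thesis using top_power_dominates[of r p D q M a d b] assms by (simp add: ac_simps)
  qed
qed

text \<open>A vector and its nonzero multiples span the same line, so the predicates under
  \<open>THE\<close> coincide. Negative \<open>r\<close> is included, which serves both orientations
  of a half-edge.\<close>

lemma slope_scaled:
  assumes "q - p = r *\<^sub>R u" "r \<noteq> 0"
  shows "slope p q = slope 0 u"
proof -
  have "(\<exists>s. r *\<^sub>R u = s *\<^sub>R z) \<longleftrightarrow> (\<exists>s. u = s *\<^sub>R z)" for z :: "real \<times> real"
  proof
    assume "\<exists>s. r *\<^sub>R u = s *\<^sub>R z"
    then obtain s where "r *\<^sub>R u = s *\<^sub>R z" by blast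
    then have "u = (s / r) *\<^sub>R z"
      using assms(2) by (metis divideR_right divide_inverse_commute scaleR_scaleR)
    then show "\<exists>s. u = s *\<^sub>R z" by blast
  qed (metis scaleR_scaleR)
  then show ?thesis by (simp only: slope_def assms(1) diff_zero)
qed

lemma closed_segment_on_line:
  fixes m h :: real
  assumes "x \<in> closed_segment p q" "snd p = h + m * fst p" "snd q = h + m * fst q"
  shows "snd x = h + m * fst x"
proof -
  obtain t where "x = (1 - t) *\<^sub>R p + t *\<^sub>R q" using assms(1) by (auto simp: in_segment)
  then have "fst x = (1 - t) * fst p + t * fst q" "snd x = (1 - t) * snd p + t * snd q"
    by simp_all
  then show ?thesis using assms(2,3) by algebra
qed

theorem theorem7:
  fixes V :: "'a set" and E :: "'a set set"
  assumes "simple_graph V E"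
  shows "\<exists>f. one_bend_drawing V E f \<and> card (one_bend_slopes E f) \<le> max_degree V E + 1"
proof -
  define D where "D = max_degree V E"
  obtain c :: "'a \<Rightarrow> 'a set \<Rightarrow> nat" where
    c_le: "\<And>v e. e \<in> E \<Longrightarrow> v \<in> e \<Longrightarrow> c v e \<le> D" and
    c_vertex: "\<And>v e e'. e \<in> E \<Longrightarrow> e' \<in> E \<Longrightarrow> v \<in> e \<Longrightarrow> v \<in> e' \<Longrightarrow> e \<noteq> e' \<Longrightarrow> c v e \<noteq> c v e'" and
    c_edge: "\<And>v w e. e \<in> E \<Longrightarrow> v \<in> e \<Longrightarrow> w \<in> e \<Longrightarrow> v \<noteq> w \<Longrightarrow> c v e \<noteq> c w e"
    unfolding D_def using half_edge_colouring[OF assms] by blast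
  have finV: "finite V" and E: "\<And>e. e \<in> E \<Longrightarrow> e \<subseteq> V \<and> card e = 2"
    using assms by (auto simp: simple_graph_def)
  have ends: "\<exists>a b. e = {a, b} \<and> a \<noteq> b \<and> a \<in> V \<and> b \<in> V" if "e \<in> E" for e
    using E[OF that] by (auto simp: card_2_iff)
  obtain g :: "'a \<Rightarrow> nat" where g: "inj_on g V"
    using finite_imp_inj_to_nat_seg[OF finV] by blast
  \<comment> \<open>This exceeds \<open>2 * D\<close>, as domination requires, and is at least 2
    even for \<open>D = 0\<close>, so that different exponents give different heights.\<close>
  define M where "M = 2 * D + 2"
  define h where "h = (\<lambda>v. real (M ^ g v))"
  have h_inj: "v = w" if "h v = h w" "v \<in> V" "w \<in> V" for v w
  proof -
    have "M ^ g v = M ^ g w" using that(1) by (simp only: h_def of_nat_eq_iff)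
    then show ?thesis using g that by (auto simp: M_def inj_on_def)
  qed
  define on_line where "on_line = (\<lambda>v k p. snd p = h v + real k * fst p)"
  \<comment> \<open>Quantifying over the ends of \<open>e\<close> avoids ordering them.\<close>
  define P where "P = (\<lambda>e. SOME p. \<forall>v\<in>e. on_line v (c v e) p)"
  have P: "on_line v (c v e) (P e)" if e: "e \<in> E" "v \<in> e" for v e
  proof -
    obtain a b where ab: "e = {a, b}" "a \<noteq> b" using ends e by blast
    \<comment> \<open>The abscissa at which the lines through \<open>a\<close> and \<open>b\<close>
      meet; they are not parallel by \<open>c_edge\<close>.\<close>
    define x where "x = (h a - h b) / (real (c b e) - real (c a e))"
    have "real (c b e) - real (c a e) \<noteq> 0" using c_edge[OF e(1), of a b] ab by simp
    then have "x * (real (c b e) - real (c a e)) = h a - h b" by (simp add: x_def)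
    then have "\<forall>v\<in>e. on_line v (c v e) (x, h a + real (c a e) * x)"
      by (auto simp: ab(1) on_line_def algebra_simps)
    then have "\<forall>v\<in>e. on_line v (c v e) (P e)" unfolding P_def by (rule someI)
    then show ?thesis using e by blast
  qed
  have fst_P: "fst (P e) \<noteq> 0" if e: "e \<in> E" for e
  proof
    assume "fst (P e) = 0"
    moreover obtain a b where ab: "e = {a, b}" "a \<noteq> b" "a \<in> V" "b \<in> V" using ends e by blast
    ultimately have "h a = h b" using P[OF e, of a] P[OF e, of b] by (simp add: on_line_def)
    then show False using h_inj ab by blast
  qed
  have not_concurrent: "\<not> on_line v k (P e)" if e: "e \<in> E" "v \<in> V" "v \<notin> e" "k \<le> D" for v k e
  proof
    assume v: "on_line v k (P e)"
    obtain a b where ab: "e = {a, b}" "a \<noteq> b" "a \<in> V" "b \<in> V" using ends e(1) by blast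
    define i j where "i = c a e" and "j = c b e"
    define x where "x = fst (P e)"
    have "x \<noteq> 0" using fst_P[OF e(1)] by (simp add: x_def)
    have a: "on_line a i (P e)" and b: "on_line b j (P e)"
      using P[OF e(1)] ab(1) by (auto simp: i_def j_def)
    have eqs: "h a + real i * x = h b + real j * x" "h a + real i * x = h v + real k * x"
      using a b v by (simp_all add: on_line_def x_def)
    have "i \<noteq> j" using c_edge e(1) ab by (simp add: i_def j_def)
    \<comment> \<open>Parallel lines through vertices of different heights share no point.\<close>
    moreover have "k \<noteq> i" using eqs h_inj[of a v] e ab by auto
    moreover have "k \<noteq> j" using eqs h_inj[of b v] e ab by auto
    moreover have "i \<le> D" "j \<le> D" using c_le[OF e(1)] ab(1) by (auto simp: i_def j_def)
    moreover have "g a \<noteq> g b" "g a \<noteq> g v" "g b \<noteq> g v"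
      using inj_onD[OF g] ab e by blast+
    ultimately have "(int j - int k) * int M ^ g a + (int k - int i) * int M ^ g b
        + (int i - int j) * int M ^ g v \<noteq> 0"
      using e(4) by (intro distinct_powers_independent[where D = D]) (auto simp: M_def)
    \<comment> \<open>With \<open>y\<close> the ordinate of \<open>P e\<close>, the heights are
      \<open>y - i * x\<close>, \<open>y - j * x\<close> and \<open>y - k * x\<close>. The three
      coefficients sum to 0, and so do their products with \<open>i\<close>, \<open>j\<close>,
      \<open>k\<close>, so \<open>y\<close> and \<open>x\<close> cancel.\<close>
    moreover have "(real j - real k) * h a + (real k - real i) * h b + (real i - real j) * h v = 0"
      using eqs by algebra
    then have "of_int ((int j - int k) * int M ^ g a + (int k - int i) * int M ^ g b
        + (int i - int j) * int M ^ g v) = (0 :: real)"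
      by (simp add: h_def)
    ultimately show False by linarith
  qed
  have bend_off_line: "\<not> on_line v (c v e') (P e)"
    if "e \<in> E" "e' \<in> E" "v \<in> e'" "e \<noteq> e'" for v e e'
  proof (cases "v \<in> e")
    case True
    then show ?thesis
      \<comment> \<open>Two lines of different slopes through \<open>v\<close> meet only on the
        y-axis, where no bend lies.\<close>
      using P[OF that(1) True] c_vertex[of e e' v] fst_P[OF that(1)] that by (auto simp: on_line_def)
  next
    case False
    then show ?thesis using not_concurrent that c_le E by blast
  qed
  define f where "f = case_sum (\<lambda>v. (0, h v)) P"
  \<comment> \<open>Even the whole line of the half-edge avoids \<open>f w\<close>: it meets the
    y-axis only at \<open>v\<close>, and \<open>bend_off_line\<close> excludes the other
    bends.\<close>
  have half_edge: "f w \<notin> closed_segment (f (Inl v)) (f (Inr e))"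
    if "e \<in> E" "v \<in> e" "w \<in> subdiv_vertices V E" "w \<noteq> Inl v" "w \<noteq> Inr e" for v e w
  proof
    assume "f w \<in> closed_segment (f (Inl v)) (f (Inr e))"
    then have line: "on_line v (c v e) (f w)"
      using closed_segment_on_line[of "f w" "(0, h v)" "P e" "h v" "real (c v e)"] P[OF that(1,2)]
      by (simp add: f_def on_line_def)
    show False
    proof (cases w)
      case (Inl u)
      then have "u \<in> V" "u \<noteq> v" "h u = h v"
        using that line by (auto simp: subdiv_vertices_def f_def on_line_def)
      then show False using h_inj E that by blast
    next
      case (Inr e')
      then show False
        using bend_off_line that line by (auto simp: subdiv_vertices_def f_def)
    qed
  qed
  \<comment> \<open>The line of a half of \<open>e'\<close> contains \<open>P e'\<close> but not
    \<open>P e\<close>.\<close>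
  have "P e \<noteq> P e'" if e: "e \<in> E" "e' \<in> E" "e \<noteq> e'" for e e'
  proof -
    obtain v where "v \<in> e'" using ends e(2) by blast
    then show ?thesis using bend_off_line e P by metis
  qed
  then have "inj_on f (subdiv_vertices V E)"
    unfolding inj_on_def subdiv_vertices_def f_def
    by (auto dest: h_inj fst_P) (metis fst_P fst_conv)+
  moreover have "f w \<notin> closed_segment (f u) (f v)"
    if uvw: "{u, v} \<in> subdiv_edges E" "w \<in> subdiv_vertices V E" "w \<notin> {u, v}" for u v w
  proof -
    obtain a e where "e \<in> E" "a \<in> e" "(u = Inl a \<and> v = Inr e) \<or> (u = Inr e \<and> v = Inl a)"
      using uvw(1) by (auto simp: subdiv_edges_def doubleton_eq_iff)
    then show ?thesis using half_edge uvw by (metis closed_segment_commute insertCI)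
  qed
  ultimately have drawing: "one_bend_drawing V E f"
    unfolding one_bend_drawing_def is_drawing_def by blast
  \<comment> \<open>Both orientations are needed because \<open>edge_slopes\<close> ranges over all
    ordered pairs \<open>u\<close>, \<open>v\<close> that form an edge.\<close>
  have slope: "slope (f (Inl v)) (f (Inr e)) = slope 0 (1, real (c v e))"
    "slope (f (Inr e)) (f (Inl v)) = slope 0 (1, real (c v e))" if "e \<in> E" "v \<in> e" for v e
  proof -
    have "f (Inr e) - f (Inl v) = fst (P e) *\<^sub>R (1, real (c v e))"
      "f (Inl v) - f (Inr e) = (- fst (P e)) *\<^sub>R (1, real (c v e))"
      using P[OF that] by (auto simp: f_def on_line_def prod_eq_iff)
    then show "slope (f (Inl v)) (f (Inr e)) = slope 0 (1, real (c v e))"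
      "slope (f (Inr e)) (f (Inl v)) = slope 0 (1, real (c v e))"
      using slope_scaled fst_P[OF that(1)] by (metis neg_equal_0_iff_equal)+
  qed
  have "one_bend_slopes E f \<subseteq> (\<lambda>k. slope 0 (1, real k)) ` {..D}"
    by (auto simp: one_bend_slopes_def edge_slopes_def subdiv_edges_def doubleton_eq_iff slope
        intro: imageI c_le)
  then have "card (one_bend_slopes E f) \<le> card {..D}" by (rule surj_card_le[rotated]) simp
  then show ?thesis using drawing by (auto simp: D_def)
qed

end
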